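(* Let $s$ be a positive integer, let $m_1\ge m_2\ge\dots\ge m_s$ be positive integers, and let $R(N_{m_1,\dots,m_s},s)$ be the complex solvable Leibniz algebra with basis $\{e_i^t : 1\le t\le s,\ 1\le i\le m_t\}\cup\{x_1,\dots,x_s\}$ and multiplication $$\begin{array}{ll} [e^t_i,e^1_1]=e^t_{i+1}, & 1\leq t\leq s,\ 1\leq i\leq m_t-1,\\ {}[e^1_i,x_1]=i\,e^1_i, & 1\leq i\leq m_1,\\ {}[e^t_i,x_1]=(i-1)e^t_i, & 2\leq t\leq s,\ 2\leq i\leq m_t,\\ {}[e^t_i,x_t]=e^t_i, & 2\leq t\leq s,\ 1\leq i\leq m_t,\\ {}[x_1,e^1_1]=-e^1_1, & \end{array}$$ all other products of basis elements being zero. Then every $2$-local derivation of $R(N_{m_1,\dots,m_s},s)$ is a derivation.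
   Context: A (right) Leibniz algebra is a vector space $\mathcal L$ with a bilinear bracket satisfying $[x,[y,z]]=[[x,y],z]-[[x,z],y]$ for all $x,y,z$. A derivation of $\mathcal L$ is a linear map $D:\mathcal L\to\mathcal L$ with $D([x,y])=[D(x),y]+[x,D(y)]$ for all $x,y\in\mathcal L$. A $2$-local derivation of $\mathcal L$ is a map $\nabla:\mathcal L\to\mathcal L$ (not necessarily linear) such that for all $x,y\in\mathcal L$ there is a derivation $D_{x,y}$ of $\mathcal L$ (depending on $x,y$) with $\nabla(x)=D_{x,y}(x)$ and $\nabla(y)=D_{x,y}(y)$.
   Formalization: The formal theorem assumes m_1 ≥ 2; for m_1 = 1 the claim is false for every s, since v ↦ (ξ²/η) e^1_1 (0 if η = 0), with ξ, η the coordinates of v at x_1 and e^1_1, is a 2-local derivation that is not additive. *)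

theory Defs
  imports Complex_Main
begin

locale leibniz_algebra = vector_space scale
  for scale :: "'k::field \<Rightarrow> 'a::ab_group_add \<Rightarrow> 'a" +
  fixes bracket :: "'a \<Rightarrow> 'a \<Rightarrow> 'a"
  assumes linear_left: "\<And>z. Vector_Spaces.linear scale scale (\<lambda>y. bracket y z)"
    and linear_right: "\<And>y. Vector_Spaces.linear scale scale (bracket y)"
    and leibniz: "\<And>u v w. bracket u (bracket v w) = bracket (bracket u v) w - bracket (bracket u w) v"

definition derivation ::
    "('k::field \<Rightarrow> 'a::ab_group_add \<Rightarrow> 'a) \<Rightarrow> ('a \<Rightarrow> 'a \<Rightarrow> 'a) \<Rightarrow> ('a \<Rightarrow> 'a) \<Rightarrow> bool" where
  "derivation scale bracket D \<longleftrightarrow>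
     Vector_Spaces.linear scale scale D \<and>
     (\<forall>u v. D (bracket u v) = bracket (D u) v + bracket u (D v))"

definition two_local_derivation ::
    "('k::field \<Rightarrow> 'a::ab_group_add \<Rightarrow> 'a) \<Rightarrow> ('a \<Rightarrow> 'a \<Rightarrow> 'a) \<Rightarrow> ('a \<Rightarrow> 'a) \<Rightarrow> bool" where
  "two_local_derivation scale bracket \<Delta> \<longleftrightarrow>
     (\<forall>u v. \<exists>D. derivation scale bracket D \<and> \<Delta> u = D u \<and> \<Delta> v = D v)"

text \<open>Labels of the basis: \<open>E t i\<close> stands for $e^t_i$ and \<open>X t\<close> for $x_t$.\<close>

datatype R_label = E nat nat | X nat

definition R_labels :: "nat \<Rightarrow> (nat \<Rightarrow> nat) \<Rightarrow> R_label set" where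
  "R_labels s m = {E t i | t i. 1 \<le> t \<and> t \<le> s \<and> 1 \<le> i \<and> i \<le> m t} \<union> {X t | t. 1 \<le> t \<and> t \<le> s}"

text \<open>In the second equation, for \<open>u = 1\<close> and \<open>t \<ge> 2\<close>, the case
  \<open>i = 1\<close> gives the coefficient \<open>0\<close>, so that product vanishes as it should.\<close>

fun R_product ::
    "(complex \<Rightarrow> 'a::ab_group_add \<Rightarrow> 'a) \<Rightarrow> (nat \<Rightarrow> nat) \<Rightarrow> (R_label \<Rightarrow> 'a)
      \<Rightarrow> R_label \<Rightarrow> R_label \<Rightarrow> 'a" where
  "R_product scale m b (E t i) (E u j) =
     (if u = 1 \<and> j = 1 \<and> i < m t then b (E t (i + 1)) else 0)"
| "R_product scale m b (E t i) (X u) =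
     (if u = 1 then (if t = 1 then scale (of_nat i) (b (E 1 i)) else scale (of_nat (i - 1)) (b (E t i)))
      else if u = t then b (E t i) else 0)"
| "R_product scale m b (X u) (E t j) =
     (if u = 1 \<and> t = 1 \<and> j = 1 then - b (E 1 1) else 0)"
| "R_product scale m b (X u) (X t) = 0"

text \<open>The Leibniz algebra $R(N_{m_1,\dots,m_s},s)$, with its basis given as the family \<open>b\<close>.\<close>

locale R_algebra = leibniz_algebra scale bracket
  for scale :: "complex \<Rightarrow> 'a::ab_group_add \<Rightarrow> 'a" and bracket :: "'a \<Rightarrow> 'a \<Rightarrow> 'a" +
  fixes s :: nat and m :: "nat \<Rightarrow> nat" and b :: "R_label \<Rightarrow> 'a"
  assumes s_pos: "1 \<le> s"
    and m_pos: "\<And>t. 1 \<le> t \<Longrightarrow> t \<le> s \<Longrightarrow> 1 \<le> m t"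
    and m_decreasing: "\<And>t u. 1 \<le> t \<Longrightarrow> t \<le> u \<Longrightarrow> u \<le> s \<Longrightarrow> m u \<le> m t"
    and basis_inj: "inj_on b (R_labels s m)"
    and basis_independent: "independent (b ` R_labels s m)"
    and basis_span: "span (b ` R_labels s m) = UNIV"
    and basis_product:
      "\<And>p q. p \<in> R_labels s m \<Longrightarrow> q \<in> R_labels s m \<Longrightarrow>
         bracket (b p) (b q) = R_product scale m b p q"

text \<open>For \<open>m 1 = 1\<close> it is false that every 2-local derivation is a derivation: with \<open>\<xi>\<close>, \<open>\<eta>\<close> the
  coordinates at $x_1$, $e^1_1$, the maps \<open>v \<mapsto> (\<alpha> \<xi> v + \<beta> \<eta> v) e\<^sup>1\<^sub>1\<close> are derivations for all
  \<open>\<alpha>\<close>, \<open>\<beta>\<close>, so every map \<open>v \<mapsto> f (\<xi> v, \<eta> v) e\<^sup>1\<^sub>1\<close> with \<open>f\<close> homogeneous of degree 1 is a 2-local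
  derivation. This is why the theorem assumes \<open>m 1 \<ge> 2\<close>.\<close>

lemma (in R_algebra) two_local_not_derivation_if_m1_eq_1:
  assumes m1: "m 1 = 1"
  shows "\<exists>\<Delta>. two_local_derivation scale bracket \<Delta> \<and> \<not> derivation scale bracket \<Delta>"
proof -
  define B where "B = b ` R_labels s m"
  define \<xi> where "\<xi> v = representation B v (b (X 1))" for v
  define \<eta> where "\<eta> v = representation B v (b (E 1 1))" for v
  define e where "e = b (E 1 1)"
  interpret vp: vector_space_pair scale scale ..
  have ind: "independent B" and spn: "\<And>v. v \<in> span B"
    using basis_independent basis_span by (auto simp: B_def)
  have X1: "X 1 \<in> R_labels s m" and E1: "E 1 1 \<in> R_labels s m"
    using s_pos m_pos[of 1] by (auto simp: R_labels_def)
  have inj: "b p = b q \<longleftrightarrow> p = q" if "p \<in> R_labels s m" "q \<in> R_labels s m" for p q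
    using basis_inj that by (auto dest: inj_onD)
  have coord: "\<xi> (b p) = (if p = X 1 then 1 else 0)" "\<eta> (b p) = (if p = E 1 1 then 1 else 0)"
    if "p \<in> R_labels s m" for p
    using that X1 E1 inj[OF that X1] inj[OF that E1] representation_basis[OF ind, of "b p"]
    by (auto simp: \<xi>_def \<eta>_def B_def)
  have add: "\<xi> (u + v) = \<xi> u + \<xi> v" "\<eta> (u + v) = \<eta> u + \<eta> v" for u v
    by (simp_all add: \<xi>_def \<eta>_def representation_add[OF ind spn spn])
  have scl: "\<xi> (scale c v) = c * \<xi> v" "\<eta> (scale c v) = c * \<eta> v" for c v
    by (simp_all add: \<xi>_def \<eta>_def representation_scale[OF ind spn])
  have bl: "bracket (u + u') v = bracket u v + bracket u' v"
    "bracket (scale c u) v = scale c (bracket u v)"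
    "bracket v (u + u') = bracket v u + bracket v u'"
    "bracket v (scale c u) = scale c (bracket v u)" for c u u' v
    using linear_left[of v] linear_right[of v] by (auto simp: Vector_Spaces.linear_iff)
  define D where "D \<alpha> \<beta> v = scale (\<alpha> * \<xi> v + \<beta> * \<eta> v) e" for \<alpha> \<beta> v
  have D: "derivation scale bracket (D \<alpha> \<beta>)" for \<alpha> \<beta>
  proof -
    have lin: "Vector_Spaces.linear scale scale (D \<alpha> \<beta>)"
      unfolding Vector_Spaces.linear_iff
      by (auto simp: D_def add scl algebra_simps vector_space_axioms)
    define F where "F u v = D \<alpha> \<beta> (bracket u v) - bracket (D \<alpha> \<beta> u) v - bracket u (D \<alpha> \<beta> v)" for u v
    have Dl: "D \<alpha> \<beta> (u + v) = D \<alpha> \<beta> u + D \<alpha> \<beta> v" "D \<alpha> \<beta> (scale c u) = scale c (D \<alpha> \<beta> u)" for c u v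
      using lin by (auto simp: Vector_Spaces.linear_iff)
    have lF: "Vector_Spaces.linear scale scale (F u)"
      "Vector_Spaces.linear scale scale (\<lambda>u. F u v)" for u v
      unfolding Vector_Spaces.linear_iff
      by (auto simp: F_def Dl bl algebra_simps vector_space_axioms)
    have sD: "D \<alpha> \<beta> (- v) = - D \<alpha> \<beta> v" "D \<alpha> \<beta> 0 = 0" for v
      using lin by (simp_all add: vp.linear_neg vp.linear_0)
    have Db: "D \<alpha> \<beta> (b p) = (if p = X 1 then scale \<alpha> e else if p = E 1 1 then scale \<beta> e else 0)"
      if "p \<in> R_labels s m" for p
      using coord[OF that] by (auto simp: D_def)
    have b0: "bracket 0 v = 0" "bracket v 0 = 0" for v
      using bl(2)[of 0 0 v] bl(4)[of v 0 0] by simp_all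
    have el: "bracket e (b q) = (if q = X 1 then e else 0)" if "q \<in> R_labels s m" for q
      using basis_product[OF E1 that] m1 by (cases q) (auto simp: e_def)
    have mt: "m t = 1" if "1 \<le> t" "t \<le> s" for t
      using m_decreasing[of 1 t] m_pos[of t] that m1 by auto
    have er: "bracket (b q) e = (if q = X 1 then - e else 0)" if "q \<in> R_labels s m" for q
      using basis_product[OF that E1] that mt by (cases q) (auto simp: e_def R_labels_def)
    have Fb: "F (b p) (b q) = 0" if p: "p \<in> R_labels s m" and q: "q \<in> R_labels s m" for p q
    proof -
      have "D \<alpha> \<beta> (bracket (b p) (b q)) =
          (if p = E 1 1 \<and> q = X 1 then scale \<beta> e else if p = X 1 \<and> q = E 1 1 then - scale \<beta> e else 0)"
        using p q mt Db[OF p] Db[OF E1] unfolding basis_product[OF p q]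
        by (cases p; cases q) (auto simp: R_labels_def Dl sD)
      then show ?thesis
        using el[OF q] er[OF p] by (auto simp: F_def Db[OF p] Db[OF q] bl b0)
    qed
    have "F (b p) v = 0" if p: "p \<in> R_labels s m" for p v
      using vp.linear_eq_0_on_span[OF lF(1), of B "b p" v] Fb[OF p] spn by (auto simp: B_def)
    then have "F u v = 0" for u v
      using vp.linear_eq_0_on_span[OF lF(2), of B v u] spn by (auto simp: B_def)
    then show ?thesis
      using lin by (auto simp: derivation_def F_def algebra_simps)
  qed
  define f where "f x y = (if y = 0 then 0 else x * x / y)" for x y :: complex
  define N where "N v = scale (f (\<xi> v) (\<eta> v)) e" for v
  have sol: "\<exists>\<alpha> \<beta>. f x y = \<alpha> * x + \<beta> * y \<and> f x' y' = \<alpha> * x' + \<beta> * y'" for x y x' y'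
  proof (cases "x * y' = x' * y")
    case True
    then have "\<exists>\<beta>. f x y = \<beta> * y \<and> f x' y' = \<beta> * y'"
      by (intro exI[of _ "if y \<noteq> 0 then (x / y)^2 else (x' / y')^2"])
        (auto simp: f_def field_simps power2_eq_square)
    then show ?thesis by (metis add_0 mult_zero_left)
  next
    case False
    then have d: "x * y' - x' * y \<noteq> 0" by simp
    have "f x y = (f x y * y' - f x' y' * y) / (x * y' - x' * y) * x + (x * f x' y' - x' * f x y) / (x * y' - x' * y) * y"
      "f x' y' = (f x y * y' - f x' y' * y) / (x * y' - x' * y) * x' + (x * f x' y' - x' * f x y) / (x * y' - x' * y) * y'"
      using d by (simp_all add: divide_simps) (simp_all add: algebra_simps)
    then show ?thesis by blast
  qed
  have "two_local_derivation scale bracket N"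
    unfolding two_local_derivation_def
  proof (intro allI)
    fix u v
    obtain \<alpha> \<beta> where "f (\<xi> u) (\<eta> u) = \<alpha> * \<xi> u + \<beta> * \<eta> u" "f (\<xi> v) (\<eta> v) = \<alpha> * \<xi> v + \<beta> * \<eta> v"
      using sol by blast
    then show "\<exists>D. derivation scale bracket D \<and> N u = D u \<and> N v = D v"
      using D by (intro exI[of _ "D \<alpha> \<beta>"]) (simp add: N_def D_def)
  qed
  moreover have "\<not> derivation scale bracket N"
  proof
    assume "derivation scale bracket N"
    then have "N (b (X 1) + b (E 1 1)) = N (b (X 1)) + N (b (E 1 1))"
      by (simp add: derivation_def Vector_Spaces.linear_iff)
    then have "e = 0"
      using coord[OF X1] coord[OF E1] by (simp add: N_def add f_def)
    then show False
      using ind E1 dependent_zero[of B] by (auto simp: e_def B_def)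
  qed
  ultimately show ?thesis by blast
qed

end

theory Submission
  imports Defs
begin

text \<open>
  Write \<open>q\<close> for the sum of the generators \<open>e\<^sub>1\<^sup>t\<close> and \<open>h\<close> for the sum of all \<open>x\<^sub>t\<close>. The whole argument
  rests on the fact that a derivation is determined by its value at the single vector \<open>q\<close>
  (lemma \<open>derivation_eq_zero_if_q\<close>). Granting this, let \<open>D\<close> be a derivation that agrees with a
  2-local derivation \<open>\<Delta>\<close> at \<open>q\<close>. For every \<open>v\<close> there is a derivation that agrees with \<open>\<Delta>\<close> at both
  \<open>v\<close> and \<open>q\<close>; it takes the same value as \<open>D\<close> at \<open>q\<close>, hence it is \<open>D\<close>, and \<open>\<Delta> v = D v\<close>.

  To see that a derivation \<open>D\<close> with \<open>D q = 0\<close> vanishes, note that right multiplication by \<open>h\<close> is a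
  grading: it multiplies \<open>e\<^sub>i\<^sup>t\<close> by \<open>i\<close> and kills every \<open>x\<^sub>t\<close>. In particular \<open>[q, h] = q\<close>, so
  \<open>[q, D h] = 0\<close>. Left multiplication by \<open>q\<close> sends \<open>x\<^sub>t\<close> to \<open>e\<^sub>1\<^sup>t\<close> and \<open>e\<^sub>1\<^sup>1\<close> to a vector with
  \<open>e\<^sub>2\<^sup>1\<close>-coordinate 1 (here \<open>m 1 \<ge> 2\<close> enters). So \<open>D h\<close> has no component along the \<open>x\<^sub>t\<close> and \<open>e\<^sub>1\<^sup>1\<close>,
  which are the only basis vectors with nonzero right multiplication. Therefore \<open>D\<close> commutes with the
  grading, and \<open>D x\<^sub>t\<close>, being of degree 0, is a combination of the \<open>x\<^sub>u\<close>. The coefficients of that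
  combination are those of \<open>D e\<^sub>1\<^sup>t = D [q, x\<^sub>t] = [q, D x\<^sub>t]\<close>, and differentiating
  \<open>e\<^sub>1\<^sup>t = [e\<^sub>1\<^sup>t, x\<^sub>t]\<close> forces all of them to be zero. So \<open>D\<close> kills the \<open>x\<^sub>t\<close> and the generators
  \<open>e\<^sub>1\<^sup>t\<close>, hence everything.
\<close>

lemma derivation_diff:
  assumes "leibniz_algebra scale bracket"
    and D: "derivation scale bracket D" "derivation scale bracket D'"
  shows "derivation scale bracket (\<lambda>v. D v - D' v)"
proof -
  interpret leibniz_algebra scale bracket by fact
  interpret vp: vector_space_pair scale scale ..
  have "Vector_Spaces.linear scale scale (\<lambda>v. D v - D' v)"
    using D by (intro vp.linear_compose_sub) (auto simp: derivation_def)
  then show ?thesis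
    using D vp.linear_diff[OF linear_left] vp.linear_diff[OF linear_right]
    by (auto simp: derivation_def)
qed

context R_algebra
begin

declare One_nat_def [simp del]

sublocale self: vector_space_pair scale scale ..

lemmas bracket_linear_simps =
  self.linear_0[OF linear_left] self.linear_0[OF linear_right]
  self.linear_add[OF linear_left] self.linear_add[OF linear_right]
  self.linear_scale[OF linear_left] self.linear_scale[OF linear_right]
  self.linear_sum[OF linear_left] self.linear_sum[OF linear_right]

lemma X_in_labels [simp]: "X t \<in> R_labels s m \<longleftrightarrow> 1 \<le> t \<and> t \<le> s"
  by (auto simp: R_labels_def)

lemma E_in_labels [simp]: "E t i \<in> R_labels s m \<longleftrightarrow> 1 \<le> t \<and> t \<le> s \<and> 1 \<le> i \<and> i \<le> m t"
  by (auto simp: R_labels_def)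

lemma finite_labels: "finite (R_labels s m)"
proof -
  have "R_labels s m \<subseteq> (\<lambda>(t, i). E t i) ` (SIGMA t:{1..s}. {1..m t}) \<union> X ` {1..s}"
    by (force simp: R_labels_def)
  then show ?thesis
    by (rule finite_subset) auto
qed

lemma basis_induct [case_names zero add scale basis]:
  assumes "P 0" "\<And>u v. P u \<Longrightarrow> P v \<Longrightarrow> P (u + v)" "\<And>c v. P v \<Longrightarrow> P (scale c v)"
    and "\<And>p. p \<in> R_labels s m \<Longrightarrow> P (b p)"
  shows "P v"
proof -
  have "v \<in> span (b ` R_labels s m)"
    using basis_span by simp
  moreover have "subspace {v. P v}"
    using assms by (auto intro: subspaceI)
  ultimately show ?thesis
    using assms(4) span_induct[of v "b ` R_labels s m" P] by auto
qed

definition coord :: "R_label \<Rightarrow> 'a \<Rightarrow> complex" where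
  "coord p v = representation (b ` R_labels s m) v (b p)"

lemma coord_add: "coord p (u + v) = coord p u + coord p v"
  by (simp add: coord_def representation_add basis_independent basis_span)

lemma coord_scale: "coord p (scale c v) = c * coord p v"
  by (simp add: coord_def representation_scale basis_independent basis_span)

lemma coord_0: "coord p 0 = 0"
  by (simp add: coord_def representation_zero)

lemma coord_sum: "coord p (sum f A) = (\<Sum>a\<in>A. coord p (f a))"
  by (induction A rule: infinite_finite_induct) (auto simp: coord_0 coord_add)

lemmas coord_linear_simps = coord_0 coord_add coord_scale coord_sum

lemma coord_basis:
  "p \<in> R_labels s m \<Longrightarrow> q \<in> R_labels s m \<Longrightarrow> coord p (b q) = (if q = p then 1 else 0)"
  using basis_inj
  by (auto simp: coord_def representation_basis basis_independent dest: inj_onD)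

lemma basis_expansion: "v = (\<Sum>p\<in>R_labels s m. scale (coord p v) (b p))"
proof (induction v rule: basis_induct)
  case (basis p)
  then have "(\<Sum>r\<in>R_labels s m. scale (coord r (b p)) (b r))
      = (\<Sum>r\<in>R_labels s m. if r = p then b p else 0)"
    by (intro sum.cong) (auto simp: coord_basis)
  with basis show ?case
    by (simp add: finite_labels)
next
  case (add u v)
  have "(\<Sum>p\<in>R_labels s m. scale (coord p (u + v)) (b p))
      = (\<Sum>p\<in>R_labels s m. scale (coord p u) (b p)) + (\<Sum>p\<in>R_labels s m. scale (coord p v) (b p))"
    by (simp add: coord_add scale_left_distrib sum.distrib)
  with add show ?case by metis
next
  case (scale c v)
  have "(\<Sum>p\<in>R_labels s m. scale (coord p (scale c v)) (b p))
      = scale c (\<Sum>p\<in>R_labels s m. scale (coord p v) (b p))"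
    by (simp add: coord_scale scale_sum_right)
  with scale show ?case by metis
qed (simp add: coord_0)

lemma eq_zero_if_coords:
  assumes "\<And>p. p \<in> R_labels s m \<Longrightarrow> coord p v = 0"
  shows "v = 0"
  by (subst basis_expansion[of v]) (simp add: assms)

definition h :: 'a where "h = (\<Sum>t = 1..s. b (X t))"

definition q :: 'a where "q = (\<Sum>t = 1..s. b (E t 1))"

text \<open>For \<open>t \<ge> 2\<close> the eigenvalue \<open>i\<close> is the sum of \<open>i - 1\<close> from \<open>x\<^sub>1\<close> and \<open>1\<close> from \<open>x\<^sub>t\<close>.\<close>

lemma bracket_E_h:
  assumes "E t i \<in> R_labels s m"
  shows "bracket (b (E t i)) h = scale (of_nat i) (b (E t i))"
proof -
  have "bracket (b (E t i)) h = (\<Sum>u = 1..s. R_product scale m b (E t i) (X u))"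
    unfolding h_def bracket_linear_simps
    using assms by (intro sum.cong) (auto simp: basis_product)
  also have "\<dots> = (\<Sum>u = 1..s. (if u = 1 then scale (of_nat (if t = 1 then i else i - 1)) (b (E t i)) else 0)
      + (if u = t then scale (of_nat (if t = 1 then 0 else 1)) (b (E t i)) else 0))"
    by (intro sum.cong) auto
  also have "\<dots> = scale (of_nat (if t = 1 then i else i - 1)) (b (E t i))
      + scale (of_nat (if t = 1 then 0 else 1)) (b (E t i))"
    using assms s_pos by (simp add: sum.distrib)
  also have "\<dots> = scale (of_nat i) (b (E t i))"
    using assms by (simp flip: scale_left_distrib add: of_nat_diff)
  finally show ?thesis .
qed

lemma bracket_X_h: "1 \<le> t \<Longrightarrow> t \<le> s \<Longrightarrow> bracket (b (X t)) h = 0"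
  unfolding h_def bracket_linear_simps by (intro sum.neutral) (auto simp: basis_product)

lemma coord_bracket_h:
  assumes "E t i \<in> R_labels s m"
  shows "coord (E t i) (bracket v h) = of_nat i * coord (E t i) v"
proof (induction v rule: basis_induct)
  case (basis p)
  then show ?case
    using assms by (cases p) (auto simp: bracket_E_h bracket_X_h coord_basis coord_linear_simps)
qed (auto simp: bracket_linear_simps coord_linear_simps algebra_simps)

lemma bracket_q_h: "bracket q h = q"
  using m_pos by (auto simp: q_def bracket_linear_simps bracket_E_h intro!: sum.cong)

lemma bracket_E1_X:
  assumes "1 \<le> t" "t \<le> s" "1 \<le> u" "u \<le> s"
  shows "bracket (b (E t 1)) (b (X u)) = (if u = t then b (E t 1) else 0)"
  using assms m_pos by (auto simp: basis_product)

lemma bracket_q_X: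
  assumes "1 \<le> t" "t \<le> s"
  shows "bracket q (b (X t)) = b (E t 1)"
  using assms by (simp add: q_def bracket_linear_simps bracket_E1_X)

lemma coord_E1_bracket_E1:
  assumes "1 \<le> t" "t \<le> s" "1 \<le> u" "u \<le> s"
  shows "coord (E u 1) (bracket (b (E t 1)) z) = (if u = t then coord (X t) z else 0)"
proof (induction z rule: basis_induct)
  case (basis p)
  then show ?case
  proof (cases p)
    case (E v j)
    then show ?thesis
      using assms basis m_pos by (auto simp: basis_product coord_basis coord_0)
  next
    case (X v)
    then show ?thesis
      using assms basis m_pos by (auto simp: bracket_E1_X coord_basis coord_0)
  qed
qed (auto simp: bracket_linear_simps coord_linear_simps)

text \<open>Right multiplication by \<open>z\<close> depends only on the components of \<open>z\<close> along the \<open>x\<^sub>t\<close> and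
  \<open>e\<^sub>1\<^sup>1\<close>; the two lemmas below read all of them off the one vector \<open>[q, z]\<close>. The component along
  \<open>e\<^sub>1\<^sup>1\<close> is visible because \<open>[e\<^sub>1\<^sup>1, e\<^sub>1\<^sup>1] = e\<^sub>2\<^sup>1\<close> when \<open>m 1 \<ge> 2\<close>.\<close>

lemma coord_E1_bracket_q:
  assumes "1 \<le> t" "t \<le> s"
  shows "coord (E t 1) (bracket q z) = coord (X t) z"
  using assms by (simp add: q_def bracket_linear_simps coord_sum coord_E1_bracket_E1)

lemma coord_E12_bracket_q:
  assumes m1: "2 \<le> m 1"
  shows "coord (E 1 2) (bracket q z) = coord (E 1 1) z"
proof (induction z rule: basis_induct)
  case (basis p)
  show ?case
  proof (cases p)
    case (E u j)
    have "bracket q (b p) = (\<Sum>t = 1..s. R_product scale m b (E t 1) p)"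
      unfolding q_def bracket_linear_simps
      using basis m_pos by (intro sum.cong) (auto simp: basis_product)
    then have "coord (E 1 2) (bracket q (b p))
        = (\<Sum>t = 1..s. coord (E 1 2) (R_product scale m b (E t 1) p))"
      by (simp add: coord_sum)
    also have "\<dots> = (\<Sum>t = 1..s. if t = 1 then (if p = E 1 1 then 1 else 0) else 0)"
      using E m1 s_pos by (intro sum.cong) (auto simp: coord_basis coord_0 numeral_2_eq_2)
    also have "\<dots> = coord (E 1 1) (b p)"
      using basis m1 s_pos by (simp add: coord_basis)
    finally show ?thesis .
  next
    case (X t)
    then show ?thesis
      using basis m1 m_pos s_pos by (auto simp: bracket_q_X coord_basis)
  qed
qed (auto simp: bracket_linear_simps coord_linear_simps)

lemma right_annihilator:
  assumes X: "\<And>t. 1 \<le> t \<Longrightarrow> t \<le> s \<Longrightarrow> coord (X t) z = 0" and E: "coord (E 1 1) z = 0"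
  shows "bracket v z = 0"
proof (induction v rule: basis_induct)
  case (basis p)
  have "scale (coord r z) (bracket (b p) (b r)) = 0" if "r \<in> R_labels s m" for r
    using that basis X E by (cases r; cases p) (auto simp: basis_product)
  then show ?case
    by (subst basis_expansion[of z]) (auto simp only: bracket_linear_simps intro!: sum.neutral)
qed (auto simp: bracket_linear_simps)

text \<open>Right multiplication by \<open>x\<^sub>t\<close> is diagonal on the \<open>e\<^sub>i\<^sup>u\<close>; among those with \<open>i = 1\<close> it keeps
  \<open>e\<^sub>1\<^sup>t\<close> and kills the others.\<close>

lemma coord_E1_bracket_X:
  assumes "1 \<le> t" "t \<le> s" "1 \<le> u" "u \<le> s"
  shows "coord (E u 1) (bracket w (b (X t))) = (if u = t then coord (E t 1) w else 0)"
proof (induction w rule: basis_induct)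
  case (basis p)
  show ?case
  proof (cases p)
    case (E v j)
    show ?thesis
    proof (cases "p = E u 1")
      case True
      then show ?thesis
        using assms m_pos by (simp add: bracket_E1_X coord_basis coord_0)
    next
      case False
      then have u: "coord (E u 1) (b p) = 0"
        using assms basis m_pos by (simp add: coord_basis)
      obtain c where "bracket (b p) (b (X t)) = scale c (b p)"
        using basis_product[OF basis, of "X t"] assms E
        by (metis R_product.simps(2) X_in_labels scale_one scale_zero_left)
      with u False show ?thesis
        using assms basis m_pos by (auto simp: coord_basis coord_scale)
    qed
  next
    case (X v)
    then show ?thesis
      using assms basis m_pos[of t] by (simp add: basis_product coord_basis coord_0)
  qed
qed (simp_all add: bracket_linear_simps coord_linear_simps)

text \<open>It suffices to show that right multiplication by \<open>D h\<close> is zero: then \<open>D\<close> preserves degrees,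
  and only the action on the \<open>x\<^sub>t\<close> and the generators \<open>e\<^sub>1\<^sup>t\<close> is left to examine.\<close>

lemma derivation_eq_zero_if_q:
  assumes m1: "2 \<le> m 1" and D: "derivation scale bracket D" and Dq: "D q = 0"
  shows "D v = 0"
proof -
  have lin: "Vector_Spaces.linear scale scale D"
    and der: "\<And>u v. D (bracket u v) = bracket (D u) v + bracket u (D v)"
    using D by (auto simp: derivation_def)
  note D_simps = self.linear_0[OF lin] self.linear_add[OF lin] self.linear_scale[OF lin]
  have q_D: "bracket q (D z) = D (bracket q z)" for z
    using der[of q z] by (simp add: Dq bracket_linear_simps)
  have "bracket q (D h) = 0"
    by (simp add: q_D bracket_q_h Dq)
  then have "bracket v (D h) = 0" for v
    using coord_E1_bracket_q[of _ "D h"] coord_E12_bracket_q[OF m1, of "D h"]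
    by (intro right_annihilator) (auto simp: coord_0)
  then have comm: "D (bracket v h) = bracket (D v) h" for v
    by (simp add: der)
  \<comment> \<open>\<open>D x\<^sub>t\<close> has degree 0, while \<open>e\<^sub>i\<^sup>u\<close> has degree \<open>i > 0\<close>.\<close>
  have DX_E: "coord p (D (b (X t))) = 0"
    if t: "1 \<le> t" "t \<le> s" and p: "p \<in> R_labels s m" "p = E u i" for t p u i
    using comm[of "b (X t)"] coord_bracket_h[of u i "D (b (X t))"] p
    by (simp add: bracket_X_h[OF t] D_simps coord_0)
  have DE_coord: "coord (E u 1) (D (b (E t 1))) = coord (X u) (D (b (X t)))"
    if t: "1 \<le> t" "t \<le> s" and u: "1 \<le> u" "u \<le> s" for t u
    using coord_E1_bracket_q[OF u, of "D (b (X t))"] by (simp add: q_D bracket_q_X[OF t])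
  have DX_X: "coord (X u) (D (b (X t))) = 0"
    if t: "1 \<le> t" "t \<le> s" and u: "1 \<le> u" "u \<le> s" for t u
  proof -
    have "D (b (E t 1)) = bracket (D (b (E t 1))) (b (X t)) + bracket (b (E t 1)) (D (b (X t)))"
      using der[of "b (E t 1)" "b (X t)"] by (simp add: bracket_E1_X t)
    then have "coord (E u 1) (D (b (E t 1))) =
        coord (E u 1) (bracket (D (b (E t 1))) (b (X t))) +
        coord (E u 1) (bracket (b (E t 1)) (D (b (X t))))"
      by (metis coord_add)
    \<comment> \<open>With \<open>c\<^sub>u\<close> the coefficient of \<open>x\<^sub>u\<close> in \<open>D x\<^sub>t\<close>, this reads \<open>c\<^sub>u = 0\<close> if \<open>u \<noteq> t\<close>, and
      \<open>c\<^sub>t = c\<^sub>t + c\<^sub>t\<close> otherwise.\<close>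
    then show ?thesis
      using DE_coord[OF t u] DE_coord[OF t t]
      by (simp add: coord_E1_bracket_X coord_E1_bracket_E1 t u split: if_splits)
  qed
  have DX: "D (b (X t)) = 0" if t: "1 \<le> t" "t \<le> s" for t
  proof (rule eq_zero_if_coords)
    fix p assume "p \<in> R_labels s m"
    then show "coord p (D (b (X t))) = 0"
      using DX_E[OF t] DX_X[OF t] by (cases p) auto
  qed
  have DE1: "D (b (E t 1)) = 0" if t: "1 \<le> t" "t \<le> s" for t
    using q_D[of "b (X t)"] by (simp add: bracket_q_X[OF t] DX[OF t] bracket_linear_simps)
  have DE: "D (b (E t (Suc i))) = 0" if "1 \<le> t" "t \<le> s" "Suc i \<le> m t" for t i
    using that
  proof (induction i)
    case (Suc i)
    then have "bracket (b (E t (Suc i))) (b (E 1 1)) = b (E t (Suc (Suc i)))"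
      using m1 s_pos by (simp add: basis_product One_nat_def)
    then show ?case
      using der[of "b (E t (Suc i))" "b (E 1 1)"] Suc DE1[of 1] s_pos
      by (simp add: bracket_linear_simps)
  qed (use DE1 in \<open>simp add: One_nat_def\<close>)
  show ?thesis
  proof (induction v rule: basis_induct)
    case (basis p)
    show ?case
    proof (cases p)
      case (E t i)
      then show ?thesis
        using basis DE[of t "i - 1"] by simp
    next
      case (X t)
      then show ?thesis
        using basis DX by simp
    qed
  qed (simp_all add: D_simps)
qed

end

theorem theorem4p2:
  fixes scale :: "complex \<Rightarrow> 'a::ab_group_add \<Rightarrow> 'a"
    and bracket :: "'a \<Rightarrow> 'a \<Rightarrow> 'a"
    and s :: nat and m :: "nat \<Rightarrow> nat" and b :: "R_label \<Rightarrow> 'a"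
    and \<Delta> :: "'a \<Rightarrow> 'a"
  assumes "R_algebra scale bracket s m b"
    and "2 \<le> m 1"
    and "two_local_derivation scale bracket \<Delta>"
  shows "derivation scale bracket \<Delta>"
proof -
  interpret R_algebra scale bracket s m b by fact
  obtain D where D: "derivation scale bracket D" "\<Delta> q = D q"
    using assms(3) unfolding two_local_derivation_def by metis
  have "\<Delta> v = D v" for v
  proof -
    obtain D' where D': "derivation scale bracket D'" "\<Delta> v = D' v" "\<Delta> q = D' q"
      using assms(3) unfolding two_local_derivation_def by metis
    have "derivation scale bracket (\<lambda>v. D v - D' v)"
      using leibniz_algebra_axioms D(1) D'(1) by (rule derivation_diff)
    moreover have "D q - D' q = 0"
      using D(2) D'(3) by simp
    ultimately have "D v - D' v = 0"
      by (rule derivation_eq_zero_if_q[OF assms(2), where D = "\<lambda>v. D v - D' v"])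
    with D'(2) show ?thesis
      by simp
  qed
  then have "\<Delta> = D"
    by (rule ext)
  with D(1) show ?thesis
    by (simp only:)
qed

end
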